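(* Let $1\le M<N$ be integers and let $\rho_{AB}$ be an $N$-qubit state (a density matrix on $(\mathbb{C}^2)^{\otimes M}\otimes(\mathbb{C}^2)^{\otimes (N-M)}$), where Alice holds the first $M$ qubits and Bob the remaining $N-M$ qubits. In the 2-setting steering protocol $\{\hat n_1,\hat n_2\}$, let $\{P_a^{\hat n_1}\}_{a}$ and $\{P_{a'}^{\hat n_2}\}_{a'}$ be Alice's two projective measurements, each consisting of the $2^M$ rank-one projectors onto the vectors of an orthonormal basis of $(\mathbb{C}^2)^{\otimes M}$, and let $\tilde\rho_a^{\hat n_1}$ and $\tilde\rho_{a'}^{\hat n_2}$ be Bob's corresponding unnormalized conditional states. Suppose that the following two requirements hold simultaneously: 1. (Pure state requirement) Bob's unnormalized conditional states $\{\tilde\rho_a^{\hat n_1}\}$ and $\{\tilde\rho_{a'}^{\hat n_2}\}$ are all pure. 2. (Measurement requirement) Any one of the pure states in $\{\tilde\rho_a^{\hat n_1}\}$ is different from any one of the pure states in $\{\tilde\rho_{a'}^{\hat n_2}\}$. Then the contradiction "2=1" arises: the quantum value is $$\sum_{a}\mathrm{tr}\,\tilde\rho_a^{\hat n_1}+\sum_{a'}\mathrm{tr}\,\tilde\rho_{a'}^{\hat n_2}=2,$$ whereas the assumption that Bob's conditional states have a local-hidden-state (LHS) description forces this same quantity to equal $1$. Consequently, Bob's conditional states $\{\tilde\rho_a^{\hat n_1}\}\cup\{\tilde\rho_{a'}^{\hat n_2}\}$ admit no LHS description.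
   Context: Conditional states: for Alice's rank-one projector $P_a^{\hat n_k}$ ($k=1,2$), Bob's unnormalized conditional state is $\tilde\rho_a^{\hat n_k}=\mathrm{tr}_A\big[(P_a^{\hat n_k}\otimes \mathbb{1})\rho_{AB}\big]$, where $\mathbb{1}$ is the $2^{N-M}\times 2^{N-M}$ identity matrix and $\mathrm{tr}_A$ is the partial trace over Alice's $M$ qubits. An unnormalized conditional state is called pure if it is a positive multiple of a rank-one orthogonal projector. Outcomes of zero probability (for which the conditional state is the zero operator) produce no state for Bob and are disregarded in the two requirements. Two unnormalized pure states are different if they are not proportional, i.e. if the associated rank-one projectors are distinct. Coincidences among conditional states belonging to the same measurement setting are allowed. LHS description: Bob's conditional states have an LHS description if there exist a (finite) index set of values $\xi$, probabilities $\wp_\xi\ge 0$ with $\sum_\xi\wp_\xi=1$, density matrices $\rho_\xi$ on Bob's space, and conditional probabilities $\wp(a|\hat n_k,\xi)\ge 0$ with $\sum_a\wp(a|\hat n_k,\xi)=1$ for every $\xi$ and $k\in\{1,2\}$, such that $$\tilde\rho_a^{\hat n_k}=\sum_\xi \wp(a|\hat n_k,\xi)\,\wp_\xi\,\rho_\xi\quad\text{for all } a \text{ and } k\in\{1,2\},\qquad \sum_\xi\wp_\xi\rho_\xi=\rho_B:=\mathrm{tr}_A(\rho_{AB}).$$ *)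

theory Defs
  imports
    "Jordan_Normal_Form.Schur_Decomposition"
    "Jordan_Normal_Form.DL_Rank"
begin

text \<open>
  The space of n qubits is identified with complex column vectors of dimension \<open>2 ^ n\<close>, and
  operators with square matrices of that size. The tensor product is the Kronecker product with the
  left factor (Alice) as the more significant part of an index: the basis vector
  \<open>|k\<rangle> \<otimes> |i\<rangle>\<close>, with \<open>i < dB\<close>, has index \<open>k * dB + i\<close>.
\<close>

definition kronecker :: "complex mat \<Rightarrow> complex mat \<Rightarrow> complex mat" where
  "kronecker A B = mat (dim_row A * dim_row B) (dim_col A * dim_col B)
     (\<lambda>(i, j). A $$ (i div dim_row B, j div dim_col B) * B $$ (i mod dim_row B, j mod dim_col B))"

definition partial_trace_left :: "nat \<Rightarrow> nat \<Rightarrow> complex mat \<Rightarrow> complex mat" where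
  "partial_trace_left dA dB X = mat dB dB (\<lambda>(i, j). \<Sum>k<dA. X $$ (k * dB + i, k * dB + j))"

definition mat_trace :: "complex mat \<Rightarrow> complex" where
  "mat_trace A = (\<Sum>i<dim_row A. A $$ (i, i))"

text \<open>In the order on \<^typ>\<open>complex\<close>, \<open>0 \<le> z\<close> means that \<open>z\<close> is real and nonnegative.\<close>

definition positive_semidefinite :: "nat \<Rightarrow> complex mat \<Rightarrow> bool" where
  "positive_semidefinite d A \<longleftrightarrow>
     A \<in> carrier_mat d d \<and> mat_adjoint A = A \<and>
     (\<forall>v \<in> carrier_vec d. 0 \<le> (A *\<^sub>v v) \<bullet>c v)"

definition density_matrix :: "nat \<Rightarrow> complex mat \<Rightarrow> bool" where
  "density_matrix d \<rho> \<longleftrightarrow> positive_semidefinite d \<rho> \<and> mat_trace \<rho> = 1"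

definition orthonormal_basis :: "nat \<Rightarrow> (nat \<Rightarrow> complex vec) \<Rightarrow> bool" where
  "orthonormal_basis d e \<longleftrightarrow>
     (\<forall>a<d. e a \<in> carrier_vec d) \<and>
     (\<forall>a<d. \<forall>b<d. e a \<bullet>c e b = (if a = b then 1 else 0)) \<and>
     vectorspace.basis class_ring (module_vec TYPE(complex) d) (e ` {..<d})"

text \<open>The operator \<open>|v\<rangle>\<langle>v|\<close>, which for a unit vector is the orthogonal projector onto its span.\<close>

definition vec_projector :: "complex vec \<Rightarrow> complex mat" where
  "vec_projector v = mat (dim_vec v) (dim_vec v) (\<lambda>(i, j). v $ i * cnj (v $ j))"

definition rank_one_projector :: "nat \<Rightarrow> complex mat \<Rightarrow> bool" where
  "rank_one_projector d P \<longleftrightarrow>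
     P \<in> carrier_mat d d \<and> P * P = P \<and> mat_adjoint P = P \<and> vec_space.rank d P = 1"

definition pure_unnormalized :: "nat \<Rightarrow> complex mat \<Rightarrow> bool" where
  "pure_unnormalized d X \<longleftrightarrow>
     (\<exists>c::real. \<exists>P. c > 0 \<and> rank_one_projector d P \<and> X = complex_of_real c \<cdot>\<^sub>m P)"

definition proportional :: "complex mat \<Rightarrow> complex mat \<Rightarrow> bool" where
  "proportional X Y \<longleftrightarrow> (\<exists>c. X = c \<cdot>\<^sub>m Y)"

text \<open>Alice holds the first M of N qubits and obtains the outcome with projector P.\<close>

definition conditional_state :: "nat \<Rightarrow> nat \<Rightarrow> complex mat \<Rightarrow> complex mat \<Rightarrow> complex mat" where
  "conditional_state M N \<rho> P =
     partial_trace_left (2 ^ M) (2 ^ (N - M)) (kronecker P (1\<^sub>m (2 ^ (N - M))) * \<rho>)"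

definition reduced_state :: "nat \<Rightarrow> nat \<Rightarrow> complex mat \<Rightarrow> complex mat" where
  "reduced_state M N \<rho> = partial_trace_left (2 ^ M) (2 ^ (N - M)) \<rho>"

definition weighted_sum :: "nat \<Rightarrow> nat set \<Rightarrow> (nat \<Rightarrow> real) \<Rightarrow> (nat \<Rightarrow> complex mat) \<Rightarrow> complex mat" where
  "weighted_sum d I w \<tau> = mat d d (\<lambda>(i, j). \<Sum>\<xi>\<in>I. complex_of_real (w \<xi>) * \<tau> \<xi> $$ (i, j))"

text \<open>
  In \<open>\<sigma> k a\<close> and \<open>p k a \<xi>\<close>, k is the setting (1 or 2) and \<open>a < dA\<close> the outcome. Hidden values
  are natural numbers, which loses nothing because the set of hidden values is finite.
\<close>

definition lhs_description ::
  "nat \<Rightarrow> nat \<Rightarrow> (nat \<Rightarrow> nat \<Rightarrow> complex mat) \<Rightarrow> complex mat \<Rightarrow> bool" where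
  "lhs_description dA dB \<sigma> \<rho>B \<longleftrightarrow>
     (\<exists>(I :: nat set) (w :: nat \<Rightarrow> real) (\<tau> :: nat \<Rightarrow> complex mat) (p :: nat \<Rightarrow> nat \<Rightarrow> nat \<Rightarrow> real).
        finite I \<and>
        (\<forall>\<xi>\<in>I. 0 \<le> w \<xi>) \<and> (\<Sum>\<xi>\<in>I. w \<xi>) = 1 \<and>
        (\<forall>\<xi>\<in>I. density_matrix dB (\<tau> \<xi>)) \<and>
        (\<forall>k\<in>{1, 2}. \<forall>\<xi>\<in>I. (\<forall>a<dA. 0 \<le> p k a \<xi>) \<and> (\<Sum>a<dA. p k a \<xi>) = 1) \<and>
        (\<forall>k\<in>{1, 2}. \<forall>a<dA. \<sigma> k a = weighted_sum dB I (\<lambda>\<xi>. p k a \<xi> * w \<xi>) \<tau>) \<and>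
        weighted_sum dB I w \<tau> = \<rho>B)"

end

theory Submission
  imports Defs
begin

text \<open>
  Both trace sums equal 1 because the projectors of an orthonormal basis add up to the identity.
  Given an LHS description, fix a hidden value \<open>\<xi>\<close> of positive probability. Each setting has an
  outcome of positive conditional probability given \<open>\<xi>\<close>, and the conditional state of that outcome
  dominates a positive multiple of \<open>\<rho>\<^sub>\<xi>\<close>; being pure, it is proportional to \<open>\<rho>\<^sub>\<xi>\<close>. Hence a
  conditional state of the first setting is proportional to one of the second, against the
  measurement requirement.
\<close>

section \<open>Entrywise formulas for self-adjoint matrices and the inner product\<close>

lemma mat_adjoint_self_index:
  assumes "A \<in> carrier_mat d d" "mat_adjoint A = A" "i < d" "j < d"
  shows "A $$ (i, j) = cnj (A $$ (j, i))"
proof -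
  have "mat_adjoint A $$ (i, j) = conjugate (A $$ (j, i))"
    using assms(1,3,4) unfolding mat_adjoint_def by (simp add: mat_of_rows_index)
  then show ?thesis using assms(2) by simp
qed

lemma mult_mat_vec_index_sum:
  assumes "A \<in> carrier_mat n m" "v \<in> carrier_vec m" "i < n"
  shows "(A *\<^sub>v v) $ i = (\<Sum>j<m. A $$ (i, j) * v $ j)"
  using assms by (auto simp: scalar_prod_def atLeast0LessThan intro!: sum.cong)

lemma cscalar_prod_sum:
  assumes "v \<in> carrier_vec d" "w \<in> carrier_vec d"
  shows "v \<bullet>c w = (\<Sum>i<d. v $ i * cnj (w $ i))"
  using assms by (auto simp: scalar_prod_def atLeast0LessThan intro!: sum.cong)

lemma mult_mat_vec_cscalar_prod_sum:
  fixes A :: "complex mat"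
  assumes "A \<in> carrier_mat d d" "v \<in> carrier_vec d" "w \<in> carrier_vec d"
  shows "(A *\<^sub>v v) \<bullet>c w = (\<Sum>i<d. \<Sum>j<d. A $$ (i, j) * v $ j * cnj (w $ i))"
proof -
  have Av: "A *\<^sub>v v \<in> carrier_vec d" using assms by auto
  show ?thesis
    unfolding cscalar_prod_sum[OF Av assms(3)]
    using mult_mat_vec_index_sum[OF assms(1,2)]
    by (simp add: sum_distrib_right del: index_mult_mat_vec)
qed

lemma mult_mat_vec_cscalar_prod_hermitian:
  fixes A :: "complex mat"
  assumes "A \<in> carrier_mat d d" "mat_adjoint A = A"
    and "v \<in> carrier_vec d" "w \<in> carrier_vec d"
  shows "(A *\<^sub>v v) \<bullet>c w = v \<bullet>c (A *\<^sub>v w)"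
proof -
  have Aw: "A *\<^sub>v w \<in> carrier_vec d" using assms by auto
  have "v \<bullet>c (A *\<^sub>v w) = (\<Sum>j<d. \<Sum>i<d. v $ j * (cnj (A $$ (j, i)) * cnj (w $ i)))"
    unfolding cscalar_prod_sum[OF assms(3) Aw]
    using mult_mat_vec_index_sum[OF assms(1,4)]
    by (simp add: sum_distrib_left del: index_mult_mat_vec)
  also have "\<dots> = (\<Sum>j<d. \<Sum>i<d. A $$ (i, j) * v $ j * cnj (w $ i))"
    using mat_adjoint_self_index[OF assms(1,2), symmetric] by (intro sum.cong refl) simp
  also have "\<dots> = (A *\<^sub>v v) \<bullet>c w"
    unfolding mult_mat_vec_cscalar_prod_sum[OF assms(1,3,4)] by (rule sum.swap)
  finally show ?thesis by simp
qed

section \<open>Positive semidefinite matrices dominated by a rank-one projector\<close>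

lemma cscalar_prod_diff_smult:
  assumes "x \<in> carrier_vec d" "y \<in> carrier_vec d" "v \<in> carrier_vec d" "w \<in> carrier_vec d"
  shows "(x - complex_of_real s \<cdot>\<^sub>v y) \<bullet>c (v - complex_of_real s \<cdot>\<^sub>v w) =
    x \<bullet>c v - complex_of_real s * (x \<bullet>c w) - complex_of_real s * (y \<bullet>c v)
      + (complex_of_real s)\<^sup>2 * (y \<bullet>c w)"
proof -
  have "(x - complex_of_real s \<cdot>\<^sub>v y) \<bullet>c (v - complex_of_real s \<cdot>\<^sub>v w) =
    (\<Sum>i<d. x $ i * cnj (v $ i) - complex_of_real s * (x $ i * cnj (w $ i))
      - complex_of_real s * (y $ i * cnj (v $ i)) + (complex_of_real s)\<^sup>2 * (y $ i * cnj (w $ i)))"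
    using assms by (subst cscalar_prod_sum[where d = d])
      (auto simp: algebra_simps power2_eq_square intro!: sum.cong)
  also have "\<dots> = x \<bullet>c v - complex_of_real s * (x \<bullet>c w) - complex_of_real s * (y \<bullet>c v)
      + (complex_of_real s)\<^sup>2 * (y \<bullet>c w)"
    using assms by (simp only: cscalar_prod_sum sum.distrib sum_subtractf sum_distrib_left)
  finally show ?thesis .
qed

text \<open>Suppose \<open>w = A v\<close> is nonzero and move \<open>v\<close> to
  \<open>u = v - s w\<close> with \<open>s\<close> real. The linear term of the form at
  \<open>u\<close> is \<open>-2 s\<close> times the squared norm of \<open>w\<close> and the
  quadratic term is of order \<open>s\<close> squared, so a small positive \<open>s\<close> makes
  the form negative, against positivity.\<close>

lemma positive_semidefinite_null_vector:
  assumes psd: "positive_semidefinite d A" and v: "v \<in> carrier_vec d"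
    and null: "(A *\<^sub>v v) \<bullet>c v = 0"
  shows "A *\<^sub>v v = 0\<^sub>v d"
proof (rule ccontr)
  assume "A *\<^sub>v v \<noteq> 0\<^sub>v d"
  define w where "w = A *\<^sub>v v"
  have A: "A \<in> carrier_mat d d" and H: "mat_adjoint A = A"
    and pos: "\<And>u. u \<in> carrier_vec d \<Longrightarrow> 0 \<le> (A *\<^sub>v u) \<bullet>c u"
    using psd by (auto simp: positive_semidefinite_def)
  have w: "w \<in> carrier_vec d" using A v by (simp add: w_def)
  have Aw: "A *\<^sub>v w \<in> carrier_vec d" using A w by auto
  have "w \<bullet>c w > 0" using \<open>A *\<^sub>v v \<noteq> 0\<^sub>v d\<close> w by (simp add: w_def)
  then have n: "Re (w \<bullet>c w) > 0" by (simp add: less_complex_def)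
  have q: "Re ((A *\<^sub>v w) \<bullet>c w) \<ge> 0" using pos[OF w] by (simp add: less_eq_complex_def)
  \<comment> \<open>With n the squared norm of \<open>w\<close> and q the form at \<open>w\<close>,
    the form at \<open>u\<close> is s (s q - 2 n). Here s (q + 1) = n, hence s q < n and the value
    is negative. The added 1 keeps the denominator positive when q = 0.\<close>
  define s where "s = Re (w \<bullet>c w) / (Re ((A *\<^sub>v w) \<bullet>c w) + 1)"
  define c where "c = complex_of_real s"
  define u where "u = v - c \<cdot>\<^sub>v w"
  have u: "u \<in> carrier_vec d" using v w by (simp add: u_def)
  have Au: "A *\<^sub>v u = w - c \<cdot>\<^sub>v (A *\<^sub>v w)"
    using A v w by (simp add: u_def w_def mult_minus_distrib_mat_vec mult_mat_vec)
  have "(A *\<^sub>v u) \<bullet>c u = w \<bullet>c v - c * (w \<bullet>c w) - c * ((A *\<^sub>v w) \<bullet>c v) + c\<^sup>2 * ((A *\<^sub>v w) \<bullet>c w)"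
    unfolding Au unfolding u_def c_def by (rule cscalar_prod_diff_smult[OF w Aw v w])
  also have "w \<bullet>c v = 0" using null by (simp add: w_def)
  also have "(A *\<^sub>v w) \<bullet>c v = w \<bullet>c w"
    using mult_mat_vec_cscalar_prod_hermitian[OF A H w v] by (simp add: w_def)
  finally have "(A *\<^sub>v u) \<bullet>c u =
      complex_of_real (s\<^sup>2) * ((A *\<^sub>v w) \<bullet>c w) - complex_of_real (2 * s) * (w \<bullet>c w)"
    by (simp add: c_def)
  then have "Re ((A *\<^sub>v u) \<bullet>c u) = s\<^sup>2 * Re ((A *\<^sub>v w) \<bullet>c w) - 2 * s * Re (w \<bullet>c w)"
    by (simp only: minus_complex.sel Re_complex_of_real times_complex.sel Im_complex_of_real)
  then have "Re ((A *\<^sub>v u) \<bullet>c u) = s * (s * Re ((A *\<^sub>v w) \<bullet>c w) - 2 * Re (w \<bullet>c w))"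
    by (simp add: power2_eq_square algebra_simps)
  moreover have "Re ((A *\<^sub>v u) \<bullet>c u) \<ge> 0" using pos[OF u] by (simp add: less_eq_complex_def)
  moreover have s: "s > 0" using n q by (simp add: s_def)
  ultimately have "s * Re ((A *\<^sub>v w) \<bullet>c w) \<ge> 2 * Re (w \<bullet>c w)"
    by (simp add: zero_le_mult_iff)
  moreover have "s * (Re ((A *\<^sub>v w) \<bullet>c w) + 1) = Re (w \<bullet>c w)" using q by (simp add: s_def)
  then have "s * Re ((A *\<^sub>v w) \<bullet>c w) + s = Re (w \<bullet>c w)" by (simp add: distrib_left)
  ultimately show False using n s by linarith
qed

text \<open>Fix a nonzero column \<open>x\<close>. Any column that is no multiple of
  \<open>x\<close> would form an independent pair with it and push the rank to 2. So
  \<open>f\<close> lists the entries of \<open>x\<close> and \<open>g\<close> the coefficients of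
  the columns with respect to \<open>x\<close>.\<close>

lemma (in vec_space) rank_1_product_entries:
  assumes A: "A \<in> carrier_mat n nc" and r: "rank A = 1"
  shows "\<exists>f g. \<forall>i<n. \<forall>j<nc. A $$ (i, j) = f i * g j"
proof (cases "\<exists>j<nc. col A j \<noteq> 0\<^sub>v n")
  \<comment> \<open>With all columns zero the constant zero functions already give a factorisation,
    so the rank need not be computed here.\<close>
  case False
  then have "\<forall>i<n. \<forall>j<nc. A $$ (i, j) = 0 * 0"
    using A by (metis carrier_matD index_col index_zero_vec(1) mult_zero_left)
  then show ?thesis by (intro exI[of _ "\<lambda>_. 0"]) simp
next
  case True
  then obtain k where k: "k < nc" "col A k \<noteq> 0\<^sub>v n" by auto
  define x where "x = col A k"
  have x: "x \<in> carrier_vec n" "x \<noteq> 0\<^sub>v n" using k A by (auto simp: x_def)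
  have "\<exists>t. col A j = t \<cdot>\<^sub>v x" if j: "j < nc" for j
  proof (rule ccontr)
    assume not: "\<nexists>t. col A j = t \<cdot>\<^sub>v x"
    define y where "y = col A j"
    have y: "y \<in> carrier_vec n" using j A by (auto simp: y_def)
    \<comment> \<open>Distinctness makes the set \<open>{x, y}\<close> have cardinality 2, which is
      what contradicts rank 1 below.\<close>
    have xy: "x \<noteq> y" using not by (metis one_smult_vec y_def)
    have "lin_indpt {x, y}"
    proof (rule finite_lin_indpt2)
      fix a assume "lincomb a {x, y} = 0\<^sub>v n"
      then have eq: "a x * x $ i + a y * y $ i = 0" if "i < n" for i
        using lincomb_index[OF that, of "{x, y}" a] x y xy that by simp
      have ay: "a y = 0"
      proof (rule ccontr)
        assume "a y \<noteq> 0"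
        then have "y = (- a x / a y) \<cdot>\<^sub>v x"
          using eq x y by (intro eq_vecI) (auto simp: field_simps eq_neg_iff_add_eq_0)
        then show False using not by (auto simp: y_def)
      qed
      have "a x = 0"
      proof (rule ccontr)
        assume "a x \<noteq> 0"
        then have "x = 0\<^sub>v n" using eq ay x by (intro eq_vecI) auto
        then show False using x by simp
      qed
      then show "\<forall>v\<in>{x, y}. a v = 0" using ay by simp
    qed (use x y in auto)
    moreover have "{x, y} \<subseteq> set (cols A)" using A j k by (auto simp: cols_def x_def y_def)
    ultimately have "card {x, y} \<le> rank A" using rank_ge_card_indpt[OF A] by blast
    then show False using xy r by simp
  qed
  then obtain t where t: "\<And>j. j < nc \<Longrightarrow> col A j = t j \<cdot>\<^sub>v x" by metis
  have "A $$ (i, j) = x $ i * t j" if "i < n" "j < nc" for i j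
  proof -
    have "A $$ (i, j) = col A j $ i" using A that by simp
    also have "\<dots> = x $ i * t j" unfolding t[OF that(2)] using that x by simp
    finally show ?thesis .
  qed
  then show ?thesis by blast
qed

text \<open>A vanishing form forces \<open>X\<close> itself to vanish on the kernel of
  \<open>P\<close>, so X = X P, and by adjoints X = P X. Thus X = P X P, and compressing to the
  one-dimensional range of \<open>P\<close> leaves only a scalar.\<close>

lemma positive_semidefinite_kernel_imp_multiple:
  assumes psd: "positive_semidefinite d X" and P: "rank_one_projector d P"
    and ker: "\<And>v. v \<in> carrier_vec d \<Longrightarrow> P *\<^sub>v v = 0\<^sub>v d \<Longrightarrow> (X *\<^sub>v v) \<bullet>c v = 0"
  shows "\<exists>t. X = t \<cdot>\<^sub>m P"
proof -
  have X: "X \<in> carrier_mat d d" and XH: "mat_adjoint X = X"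
    using psd by (auto simp: positive_semidefinite_def)
  have Pc: "P \<in> carrier_mat d d" and PP: "P * P = P" and PH: "mat_adjoint P = P"
    and rk: "vec_space.rank d P = 1"
    using P by (auto simp: rank_one_projector_def)
  \<comment> \<open>Since \<open>P\<close> is idempotent, v - P v lies in its kernel, and
    \<open>X\<close> annihilates it.\<close>
  have XP: "X *\<^sub>v (P *\<^sub>v v) = X *\<^sub>v v" if v: "v \<in> carrier_vec d" for v
  proof -
    have Pv: "P *\<^sub>v v \<in> carrier_vec d" using Pc v by auto
    have "P *\<^sub>v (P *\<^sub>v v) = P *\<^sub>v v"
      using assoc_mult_mat_vec[OF Pc Pc v] PP by simp
    then have "P *\<^sub>v (v - P *\<^sub>v v) = 0\<^sub>v d"
      using Pc v Pv by (simp add: mult_minus_distrib_mat_vec)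
    then have "X *\<^sub>v (v - P *\<^sub>v v) = 0\<^sub>v d"
      using v Pv by (intro positive_semidefinite_null_vector[OF psd] ker minus_carrier_vec)
    then have eq: "X *\<^sub>v v - X *\<^sub>v (P *\<^sub>v v) = 0\<^sub>v d"
      using X v Pv by (simp add: mult_minus_distrib_mat_vec)
    show ?thesis
    proof (rule eq_vecI)
      fix i assume "i < dim_vec (X *\<^sub>v v)"
      then have i: "i < d" using X by simp
      have "(X *\<^sub>v v - X *\<^sub>v (P *\<^sub>v v)) $ i = 0" using eq i by simp
      then show "(X *\<^sub>v (P *\<^sub>v v)) $ i = (X *\<^sub>v v) $ i"
        using X i by (simp del: index_mult_mat_vec)
    qed (use X in simp)
  qed
  \<comment> \<open>This is X = X P, read off from \<open>XP\<close> at the unit vectors;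
    \<open>left\<close> is its adjoint, P X = X.\<close>
  have right: "X $$ (i, j) = (\<Sum>k<d. X $$ (i, k) * P $$ (k, j))" if "i < d" "j < d" for i j
  proof -
    have u: "unit_vec d j \<in> carrier_vec d" by simp
    have c: "P *\<^sub>v unit_vec d j = col P j" "X *\<^sub>v unit_vec d j = col X j"
      using Pc X that by (auto intro!: eq_vecI simp: scalar_prod_right_unit)
    have "(X *\<^sub>v col P j) $ i = X $$ (i, j)" using XP[OF u] c X that by simp
    moreover have "(X *\<^sub>v col P j) $ i = (\<Sum>k<d. X $$ (i, k) * col P j $ k)"
      using mult_mat_vec_index_sum[OF X _ that(1)] Pc that by auto
    ultimately show ?thesis using Pc that by simp
  qed
  have left: "X $$ (i, j) = (\<Sum>k<d. P $$ (i, k) * X $$ (k, j))" if "i < d" "j < d" for i j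
  proof -
    have "X $$ (i, j) = cnj (X $$ (j, i))" using mat_adjoint_self_index[OF X XH that] .
    also have "\<dots> = (\<Sum>k<d. cnj (X $$ (j, k)) * cnj (P $$ (k, i)))"
      by (subst right[OF that(2,1)]) simp
    also have "\<dots> = (\<Sum>k<d. P $$ (i, k) * X $$ (k, j))"
      using that
      by (intro sum.cong refl)
        (simp add: mat_adjoint_self_index[OF X XH, symmetric] mat_adjoint_self_index[OF Pc PH, symmetric])
    finally show ?thesis .
  qed
  obtain f g where fg: "\<And>i j. i < d \<Longrightarrow> j < d \<Longrightarrow> P $$ (i, j) = f i * g j"
    using vec_space.rank_1_product_entries[OF Pc rk] by blast
  \<comment> \<open>Writing \<open>P\<close> as the column \<open>f\<close> times the row
    \<open>g\<close>, the product P X P is f (g X f) g. The inner factor is the scalar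
    \<open>t\<close>.\<close>
  define t where "t = (\<Sum>k<d. \<Sum>l<d. g k * X $$ (k, l) * f l)"
  have "X $$ (i, j) = t * P $$ (i, j)" if "i < d" "j < d" for i j
  proof -
    have "X $$ (i, j) = (\<Sum>k<d. P $$ (i, k) * (\<Sum>l<d. X $$ (k, l) * P $$ (l, j)))"
      unfolding left[OF that] using right[symmetric] that by (intro sum.cong refl) simp
    also have "\<dots> = (\<Sum>k<d. \<Sum>l<d. (g k * X $$ (k, l) * f l) * (f i * g j))"
      using fg that by (simp add: sum_distrib_left mult_ac)
    also have "\<dots> = t * P $$ (i, j)" using fg that by (simp add: t_def sum_distrib_right)
    finally show ?thesis .
  qed
  then have "X = t \<cdot>\<^sub>m P" using X Pc by (intro eq_matI) auto
  then show ?thesis by blast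
qed

section \<open>Pure mixtures and hidden states\<close>

lemma mult_weighted_sum_cscalar_prod:
  assumes "\<And>\<xi>. \<xi> \<in> I \<Longrightarrow> \<tau> \<xi> \<in> carrier_mat d d" and v: "v \<in> carrier_vec d"
  shows "(weighted_sum d I w \<tau> *\<^sub>v v) \<bullet>c v = (\<Sum>\<xi>\<in>I. complex_of_real (w \<xi>) * ((\<tau> \<xi> *\<^sub>v v) \<bullet>c v))"
proof -
  have W: "weighted_sum d I w \<tau> \<in> carrier_mat d d" by (simp add: weighted_sum_def)
  have "(weighted_sum d I w \<tau> *\<^sub>v v) \<bullet>c v =
      (\<Sum>i<d. \<Sum>j<d. \<Sum>\<xi>\<in>I. complex_of_real (w \<xi>) * (\<tau> \<xi> $$ (i, j) * v $ j * cnj (v $ i)))"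
    unfolding mult_mat_vec_cscalar_prod_sum[OF W v v]
    by (intro sum.cong refl) (simp add: weighted_sum_def sum_distrib_right sum_distrib_left mult_ac)
  also have "\<dots> = (\<Sum>i<d. \<Sum>\<xi>\<in>I. \<Sum>j<d. complex_of_real (w \<xi>) * (\<tau> \<xi> $$ (i, j) * v $ j * cnj (v $ i)))"
    by (intro sum.cong refl sum.swap)
  also have "\<dots> = (\<Sum>\<xi>\<in>I. \<Sum>i<d. \<Sum>j<d. complex_of_real (w \<xi>) * (\<tau> \<xi> $$ (i, j) * v $ j * cnj (v $ i)))"
    by (rule sum.swap)
  also have "\<dots> = (\<Sum>\<xi>\<in>I. complex_of_real (w \<xi>) * ((\<tau> \<xi> *\<^sub>v v) \<bullet>c v))"
    by (intro sum.cong refl) (simp only: mult_mat_vec_cscalar_prod_sum[OF assms(1) v v] sum_distrib_left)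
  finally show ?thesis .
qed

text \<open>Used to see that a mixture of positive total weight is not the zero operator, so that
  the purity assumption applies to it.\<close>

lemma mat_trace_weighted_sum:
  assumes "\<And>\<xi>. \<xi> \<in> I \<Longrightarrow> density_matrix d (\<tau> \<xi>)"
  shows "mat_trace (weighted_sum d I w \<tau>) = complex_of_real (\<Sum>\<xi>\<in>I. w \<xi>)"
proof -
  have "mat_trace (weighted_sum d I w \<tau>) = (\<Sum>\<xi>\<in>I. \<Sum>i<d. complex_of_real (w \<xi>) * \<tau> \<xi> $$ (i, i))"
    unfolding mat_trace_def weighted_sum_def by (simp add: sum.swap[of _ I])
  also have "\<dots> = (\<Sum>\<xi>\<in>I. complex_of_real (w \<xi>) * mat_trace (\<tau> \<xi>))"
  proof (intro sum.cong refl)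
    fix \<xi> assume "\<xi> \<in> I"
    then have "dim_row (\<tau> \<xi>) = d"
      using assms by (auto simp: density_matrix_def positive_semidefinite_def)
    then show "(\<Sum>i<d. complex_of_real (w \<xi>) * \<tau> \<xi> $$ (i, i)) = complex_of_real (w \<xi>) * mat_trace (\<tau> \<xi>)"
      by (simp add: mat_trace_def sum_distrib_left)
  qed
  also have "\<dots> = complex_of_real (\<Sum>\<xi>\<in>I. w \<xi>)"
    using assms by (simp add: density_matrix_def)
  finally show ?thesis .
qed

text \<open>On the kernel of the projector \<open>P\<close> the form of the mixture is zero, but it
  is a sum of nonnegative terms, so each term is zero. The component at \<open>\<zeta>\<close> has
  positive weight, hence its own form vanishes there and it is a multiple of \<open>P\<close>. The
  weights may have any total, as the products \<open>p k a \<xi> * w \<xi>\<close> require.\<close>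

lemma pure_weighted_sum_component:
  assumes fin: "finite I" and w: "\<And>\<xi>. \<xi> \<in> I \<Longrightarrow> 0 \<le> w \<xi>"
    and dens: "\<And>\<xi>. \<xi> \<in> I \<Longrightarrow> density_matrix d (\<tau> \<xi>)"
    and pure: "pure_unnormalized d (weighted_sum d I w \<tau>)"
    and \<zeta>: "\<zeta> \<in> I" "w \<zeta> > 0"
  shows "\<exists>t. \<tau> \<zeta> = t \<cdot>\<^sub>m weighted_sum d I w \<tau>"
proof -
  obtain c P where c: "c > 0" and P: "rank_one_projector d P"
    and W: "weighted_sum d I w \<tau> = complex_of_real c \<cdot>\<^sub>m P"
    using pure by (auto simp: pure_unnormalized_def)
  have Pc: "P \<in> carrier_mat d d" using P by (simp add: rank_one_projector_def)
  have psd: "positive_semidefinite d (\<tau> \<xi>)" if "\<xi> \<in> I" for \<xi>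
    using dens[OF that] by (simp add: density_matrix_def)
  have "(\<tau> \<zeta> *\<^sub>v v) \<bullet>c v = 0" if v: "v \<in> carrier_vec d" and Pv: "P *\<^sub>v v = 0\<^sub>v d" for v
  proof -
    have "weighted_sum d I w \<tau> *\<^sub>v v = 0\<^sub>v d"
    proof (rule eq_vecI)
      fix i assume "i < dim_vec (0\<^sub>v d)"
      then show "(weighted_sum d I w \<tau> *\<^sub>v v) $ i = 0\<^sub>v d $ i"
        using arg_cong[OF Pv, of "\<lambda>u. u $ i"] Pc v unfolding W by simp
    qed (simp add: weighted_sum_def)
    then have "(weighted_sum d I w \<tau> *\<^sub>v v) \<bullet>c v = 0" using v by simp
    then have sum0: "(\<Sum>\<xi>\<in>I. complex_of_real (w \<xi>) * ((\<tau> \<xi> *\<^sub>v v) \<bullet>c v)) = 0"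
      using mult_weighted_sum_cscalar_prod[of I \<tau> d v w] psd v
      by (simp add: positive_semidefinite_def)
    have "complex_of_real (w \<xi>) * ((\<tau> \<xi> *\<^sub>v v) \<bullet>c v) \<ge> 0" if "\<xi> \<in> I" for \<xi>
      using w[OF that] psd[OF that] v
      by (intro mult_nonneg_nonneg) (auto simp: positive_semidefinite_def less_eq_complex_def)
    then have "complex_of_real (w \<zeta>) * ((\<tau> \<zeta> *\<^sub>v v) \<bullet>c v) = 0"
      using sum0 \<zeta>(1) fin by (simp add: sum_nonneg_eq_0_iff)
    then show ?thesis using \<zeta>(2) by simp
  qed
  then obtain t where "\<tau> \<zeta> = t \<cdot>\<^sub>m P"
    using positive_semidefinite_kernel_imp_multiple[OF psd[OF \<zeta>(1)] P] by blast
  \<comment> \<open>Because \<open>c\<close> is positive, \<open>P\<close> can be traded for the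
    mixture itself.\<close>
  then have "\<tau> \<zeta> = (t / complex_of_real c) \<cdot>\<^sub>m weighted_sum d I w \<tau>"
    unfolding W using c Pc by (intro eq_matI) auto
  then show ?thesis by blast
qed

lemma lhs_description_imp_proportional:
  assumes lhs: "lhs_description dA dB \<sigma> \<rho>B"
    and pure: "\<And>k a. k \<in> {1, 2} \<Longrightarrow> a < dA \<Longrightarrow> \<sigma> k a \<noteq> 0\<^sub>m dB dB \<Longrightarrow> pure_unnormalized dB (\<sigma> k a)"
  shows "\<exists>a<dA. \<exists>b<dA. \<sigma> 1 a \<noteq> 0\<^sub>m dB dB \<and> \<sigma> 2 b \<noteq> 0\<^sub>m dB dB \<and> proportional (\<sigma> 1 a) (\<sigma> 2 b)"
proof -
  obtain I w \<tau> p where fin: "finite I"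
    and w': "\<forall>\<xi>\<in>I. (0::real) \<le> w \<xi>" and w1: "(\<Sum>\<xi>\<in>I. w \<xi>) = 1"
    and dens': "\<forall>\<xi>\<in>I. density_matrix dB (\<tau> \<xi>)"
    and p': "\<forall>k\<in>{1, 2}. \<forall>\<xi>\<in>I. (\<forall>a<dA. (0::real) \<le> p k a \<xi>) \<and> (\<Sum>a<dA. p k a \<xi>) = 1"
    and \<sigma>': "\<forall>k\<in>{1, 2}. \<forall>a<dA. \<sigma> k a = weighted_sum dB I (\<lambda>\<xi>. p k a \<xi> * w \<xi>) \<tau>"
    using lhs unfolding lhs_description_def by (elim exE conjE)
  have w: "0 \<le> w \<xi>" and dens: "density_matrix dB (\<tau> \<xi>)" if "\<xi> \<in> I" for \<xi>
    using w' dens' that by blast+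
  have p: "\<And>a. a < dA \<Longrightarrow> 0 \<le> p k a \<xi>" and p1: "(\<Sum>a<dA. p k a \<xi>) = 1"
    if "k \<in> {1, 2}" "\<xi> \<in> I" for k \<xi>
    using p' that by blast+
  have \<sigma>: "\<sigma> k a = weighted_sum dB I (\<lambda>\<xi>. p k a \<xi> * w \<xi>) \<tau>" if "k \<in> {1, 2}" "a < dA" for k a
    using \<sigma>' that by blast
  \<comment> \<open>The weights are nonnegative with sum 1, so they cannot all be zero; the same
    argument yields the outcome \<open>a\<close> in \<open>comp\<close>. One \<open>\<zeta>\<close>
    serves both settings and so links them.\<close>
  obtain \<zeta> where \<zeta>: "\<zeta> \<in> I" "w \<zeta> > 0"
    using w w1 by (metis less_eq_real_def sum.neutral zero_neq_one)
  have comp: "\<exists>a<dA. \<sigma> k a \<noteq> 0\<^sub>m dB dB \<and> (\<exists>t. \<tau> \<zeta> = t \<cdot>\<^sub>m \<sigma> k a)" if k: "k \<in> {1, 2}" for k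
  proof -
    obtain a where a: "a < dA" "p k a \<zeta> > 0"
      using p[OF k \<zeta>(1)] p1[OF k \<zeta>(1)] by (metis lessThan_iff less_eq_real_def sum.neutral zero_neq_one)
    have nn: "p k a \<xi> * w \<xi> \<ge> 0" if "\<xi> \<in> I" for \<xi>
      using p[OF k that a(1)] w[OF that] by simp
    have pos: "p k a \<zeta> * w \<zeta> > 0" using a \<zeta> by simp
    \<comment> \<open>Purity is assumed only for nonzero conditional states. The trace is the
      probability of the outcome, and the term at \<open>\<zeta>\<close> makes it positive.\<close>
    have tr: "mat_trace (\<sigma> k a) = complex_of_real (\<Sum>\<xi>\<in>I. p k a \<xi> * w \<xi>)"
      unfolding \<sigma>[OF k a(1)] by (intro mat_trace_weighted_sum dens)
    have "(\<Sum>\<xi>\<in>I. p k a \<xi> * w \<xi>) > 0" using fin nn \<zeta>(1) pos by (intro sum_pos2)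
    then have "mat_trace (\<sigma> k a) \<noteq> 0"
      unfolding tr of_real_eq_0_iff by simp
    then have nz: "\<sigma> k a \<noteq> 0\<^sub>m dB dB" by (auto simp: mat_trace_def)
    then have "pure_unnormalized dB (weighted_sum dB I (\<lambda>\<xi>. p k a \<xi> * w \<xi>) \<tau>)"
      using pure[OF k a(1)] \<sigma>[OF k a(1)] by simp
    then have "\<exists>t. \<tau> \<zeta> = t \<cdot>\<^sub>m \<sigma> k a"
      unfolding \<sigma>[OF k a(1)]
      by (intro pure_weighted_sum_component[where w = "\<lambda>\<xi>. p k a \<xi> * w \<xi>"] fin nn dens \<zeta>(1) pos)
    then show ?thesis using nz a(1) by blast
  qed
  obtain a t where a: "a < dA" "\<sigma> 1 a \<noteq> 0\<^sub>m dB dB" "\<tau> \<zeta> = t \<cdot>\<^sub>m \<sigma> 1 a"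
    using comp[of 1] by auto
  obtain b u where b: "b < dA" "\<sigma> 2 b \<noteq> 0\<^sub>m dB dB" "\<tau> \<zeta> = u \<cdot>\<^sub>m \<sigma> 2 b"
    using comp[of 2] by auto
  have c: "\<sigma> 1 a \<in> carrier_mat dB dB" "\<sigma> 2 b \<in> carrier_mat dB dB"
    using \<sigma>[of 1 a] \<sigma>[of 2 b] a(1) b(1) by (auto simp: weighted_sum_def)
  \<comment> \<open>A hidden state has trace 1, so it is not the zero multiple; dividing by
    \<open>t\<close> then carries proportionality from one setting to the other through
    \<open>\<tau> \<zeta>\<close>.\<close>
  have "t \<noteq> 0"
  proof
    assume "t = 0"
    then have "mat_trace (\<tau> \<zeta>) = 0" using a(3) c by (simp add: mat_trace_def)
    then show False using dens[OF \<zeta>(1)] by (simp add: density_matrix_def)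
  qed
  then have "\<sigma> 1 a = (1 / t) \<cdot>\<^sub>m \<tau> \<zeta>" using c unfolding a(3) by (intro eq_matI) auto
  also have "\<dots> = (u / t) \<cdot>\<^sub>m \<sigma> 2 b" using c unfolding b(3) by (intro eq_matI) auto
  finally show ?thesis using a b unfolding proportional_def by blast
qed

section \<open>Resolution of the identity and the quantum value\<close>

lemma orthonormal_basis_projectors_sum:
  assumes e: "orthonormal_basis d e" and i: "i < d" and j: "j < d"
  shows "(\<Sum>a<d. vec_projector (e a) $$ (i, j)) = (if i = j then 1 else 0)"
proof -
  \<comment> \<open>The columns of \<open>U\<close> are the basis vectors and \<open>V\<close> is
    its conjugate transpose. Orthonormality says that V U is the identity, whereas the sum of the
    projectors is U V; for square matrices the first gives the second.\<close>
  define U where "U = mat d d (\<lambda>(i, a). e a $ i)"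
  define V where "V = mat d d (\<lambda>(a, i). cnj (e a $ i))"
  have U: "U \<in> carrier_mat d d" and V: "V \<in> carrier_mat d d" by (auto simp: U_def V_def)
  have ec: "e a \<in> carrier_vec d" if "a < d" for a
    using e that by (simp add: orthonormal_basis_def)
  have "(V * U) $$ (a, b) = 1\<^sub>m d $$ (a, b)" if "a < d" "b < d" for a b
  proof -
    have "(V * U) $$ (a, b) = (\<Sum>i<d. e b $ i * cnj (e a $ i))"
      using that by (auto simp: U_def V_def scalar_prod_def atLeast0LessThan mult_ac intro!: sum.cong)
    also have "\<dots> = e b \<bullet>c e a" using cscalar_prod_sum[OF ec ec] that by simp
    also have "\<dots> = 1\<^sub>m d $$ (a, b)" using e that by (auto simp: orthonormal_basis_def)
    finally show ?thesis .
  qed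
  then have "V * U = 1\<^sub>m d" using U V by (intro eq_matI) auto
  then have UV: "U * V = 1\<^sub>m d" by (rule mat_mult_left_right_inverse[OF V U])
  have "(\<Sum>a<d. vec_projector (e a) $$ (i, j)) = (\<Sum>a<d. e a $ i * cnj (e a $ j))"
    using i j carrier_vecD[OF ec] by (intro sum.cong refl) (simp add: vec_projector_def)
  also have "\<dots> = (U * V) $$ (i, j)"
    using i j by (auto simp: U_def V_def scalar_prod_def atLeast0LessThan intro!: sum.cong)
  finally show ?thesis using UV i j by simp
qed

text \<open>The diagonal index k * dB + i runs through \<open>dA\<close> consecutive blocks of
  length \<open>dB\<close>, so the double sum is the full diagonal sum cut into blocks.\<close>

lemma mat_trace_partial_trace_left:
  assumes "X \<in> carrier_mat (dA * dB) (dA * dB)"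
  shows "mat_trace (partial_trace_left dA dB X) = mat_trace X"
proof -
  have "mat_trace (partial_trace_left dA dB X) = (\<Sum>i<dB. \<Sum>k<dA. X $$ (k * dB + i, k * dB + i))"
    by (simp add: mat_trace_def partial_trace_left_def)
  also have "\<dots> = (\<Sum>k<dA. \<Sum>i<dB. X $$ (k * dB + i, k * dB + i))" by (rule sum.swap)
  also have "\<dots> = (\<Sum>k<dA. \<Sum>r = k * dB..<k * dB + dB. X $$ (r, r))"
  proof (rule sum.cong[OF refl])
    fix k
    show "(\<Sum>i<dB. X $$ (k * dB + i, k * dB + i)) = (\<Sum>r = k * dB..<k * dB + dB. X $$ (r, r))"
      using sum.shift_bounds_nat_ivl[of "\<lambda>r. X $$ (r, r)" 0 "k * dB" dB]
      by (simp add: atLeast0LessThan add.commute)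
  qed
  also have "\<dots> = mat_trace X"
    using assms sum.nat_group[of "\<lambda>r. X $$ (r, r)" dB dA] by (simp add: mat_trace_def)
  finally show ?thesis .
qed

text \<open>The partial trace preserves the trace, and the trace is linear. So the sum over outcomes
  is the trace of \<open>\<rho>\<close> multiplied by the sum of the operators \<open>K a\<close>,
  which is the identity.\<close>

lemma sum_mat_trace_conditional_state:
  assumes MN: "M \<le> N" and \<rho>: "\<rho> \<in> carrier_mat (2 ^ N) (2 ^ N)"
    and e: "orthonormal_basis (2 ^ M) e"
  shows "(\<Sum>a<2 ^ M. mat_trace (conditional_state M N \<rho> (vec_projector (e a)))) = mat_trace \<rho>"
proof -
  define dA :: nat where "dA = 2 ^ M"
  define dB :: nat where "dB = 2 ^ (N - M)"
  define K where "K a = kronecker (vec_projector (e a)) (1\<^sub>m dB)" for a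
  have D: "2 ^ N = dA * dB" using MN by (simp add: dA_def dB_def flip: power_add)
  have dB: "dB > 0" by (simp add: dB_def)
  have e': "orthonormal_basis dA e" using e by (simp add: dA_def)
  have \<rho>': "\<rho> \<in> carrier_mat (dA * dB) (dA * dB)" using \<rho> D by simp
  have ec: "dim_vec (e a) = dA" if "a < dA" for a
    using e' that by (auto simp: orthonormal_basis_def)
  have K: "K a \<in> carrier_mat (dA * dB) (dA * dB)" if "a < dA" for a
    using ec[OF that] by (simp add: K_def kronecker_def vec_projector_def)
  \<comment> \<open>Quotient and remainder by \<open>dB\<close> separate Alice's index from Bob's.
    Alice's projectors sum to the identity, Bob's factor is the identity, and equal quotients and
    remainders mean equal indices.\<close>
  have sumK: "(\<Sum>a<dA. K a $$ (r, s)) = (if r = s then 1 else 0)"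
    if "r < dA * dB" "s < dA * dB" for r s
  proof -
    have rs: "r div dB < dA" "s div dB < dA"
      using that dB by (simp_all add: less_mult_imp_div_less)
    have "(\<Sum>a<dA. K a $$ (r, s)) =
        (\<Sum>a<dA. vec_projector (e a) $$ (r div dB, s div dB)) * (1\<^sub>m dB $$ (r mod dB, s mod dB))"
      unfolding sum_distrib_right using that ec dB
      by (intro sum.cong refl) (simp add: K_def kronecker_def vec_projector_def)
    also have "\<dots> = (if r div dB = s div dB \<and> r mod dB = s mod dB then 1 else 0)"
      using orthonormal_basis_projectors_sum[OF e' rs] dB by simp
    also have "r div dB = s div dB \<and> r mod dB = s mod dB \<longleftrightarrow> r = s"
      by (metis div_mult_mod_eq)
    finally show ?thesis .
  qed
  have "(\<Sum>a<dA. mat_trace (conditional_state M N \<rho> (vec_projector (e a)))) = (\<Sum>a<dA. mat_trace (K a * \<rho>))"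
  proof (intro sum.cong refl)
    fix a assume "a \<in> {..<dA}"
    then have "K a * \<rho> \<in> carrier_mat (dA * dB) (dA * dB)" using K \<rho>' by (auto intro: mult_carrier_mat)
    then show "mat_trace (conditional_state M N \<rho> (vec_projector (e a))) = mat_trace (K a * \<rho>)"
      using mat_trace_partial_trace_left by (simp add: conditional_state_def K_def dA_def dB_def)
  qed
  also have "\<dots> = (\<Sum>a<dA. \<Sum>r<dA * dB. \<Sum>s<dA * dB. K a $$ (r, s) * \<rho> $$ (s, r))"
  proof (intro sum.cong refl)
    fix a assume "a \<in> {..<dA}"
    then show "mat_trace (K a * \<rho>) = (\<Sum>r<dA * dB. \<Sum>s<dA * dB. K a $$ (r, s) * \<rho> $$ (s, r))"
      using K[of a] \<rho>' by (auto simp: mat_trace_def scalar_prod_def atLeast0LessThan intro!: sum.cong)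
  qed
  also have "\<dots> = (\<Sum>r<dA * dB. \<Sum>s<dA * dB. (\<Sum>a<dA. K a $$ (r, s)) * \<rho> $$ (s, r))"
    by (simp add: sum_distrib_right sum.swap[of _ "{..<dA}"])
  also have "\<dots> = (\<Sum>r<dA * dB. \<Sum>s<dA * dB. if r = s then \<rho> $$ (s, r) else 0)"
    using sumK by (intro sum.cong refl) auto
  also have "\<dots> = mat_trace \<rho>" using \<rho>' by (simp add: mat_trace_def)
  finally show ?thesis by (simp add: dA_def)
qed

theorem theorem1:
  fixes M N :: nat and \<rho> :: "complex mat"
    and e :: "nat \<Rightarrow> nat \<Rightarrow> complex vec"
    and \<sigma> :: "nat \<Rightarrow> nat \<Rightarrow> complex mat"
  assumes "1 \<le> M" and "M < N"
    and state: "density_matrix (2 ^ N) \<rho>"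
    and bases: "\<forall>k\<in>{1, 2}. orthonormal_basis (2 ^ M) (e k)"
    and sigma: "\<forall>k\<in>{1, 2}. \<forall>a<2 ^ M. \<sigma> k a = conditional_state M N \<rho> (vec_projector (e k a))"
    and pure_req: "\<forall>k\<in>{1, 2}. \<forall>a<2 ^ M.
      \<sigma> k a \<noteq> 0\<^sub>m (2 ^ (N - M)) (2 ^ (N - M)) \<longrightarrow> pure_unnormalized (2 ^ (N - M)) (\<sigma> k a)"
    and measurement_req: "\<forall>a<2 ^ M. \<forall>a'<2 ^ M.
      \<sigma> 1 a \<noteq> 0\<^sub>m (2 ^ (N - M)) (2 ^ (N - M)) \<longrightarrow>
      \<sigma> 2 a' \<noteq> 0\<^sub>m (2 ^ (N - M)) (2 ^ (N - M)) \<longrightarrow> \<not> proportional (\<sigma> 1 a) (\<sigma> 2 a')"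
  shows "(\<Sum>a<2 ^ M. mat_trace (\<sigma> 1 a)) + (\<Sum>a'<2 ^ M. mat_trace (\<sigma> 2 a')) = 2 \<and>
    (lhs_description (2 ^ M) (2 ^ (N - M)) \<sigma> (reduced_state M N \<rho>) \<longrightarrow>
       (\<Sum>a<2 ^ M. mat_trace (\<sigma> 1 a)) + (\<Sum>a'<2 ^ M. mat_trace (\<sigma> 2 a')) = 1) \<and>
    \<not> lhs_description (2 ^ M) (2 ^ (N - M)) \<sigma> (reduced_state M N \<rho>)"
proof -
  have \<rho>: "\<rho> \<in> carrier_mat (2 ^ N) (2 ^ N)" "mat_trace \<rho> = 1"
    using state by (auto simp: density_matrix_def positive_semidefinite_def)
  have "(\<Sum>a<2 ^ M. mat_trace (\<sigma> k a)) = 1" if k: "k \<in> {1, 2}" for k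
    using sum_mat_trace_conditional_state[OF less_imp_le[OF \<open>M < N\<close>] \<rho>(1), of "e k"] \<rho>(2)
      bspec[OF bases k] bspec[OF sigma k] by simp
  then have "(\<Sum>a<2 ^ M. mat_trace (\<sigma> 1 a)) + (\<Sum>a'<2 ^ M. mat_trace (\<sigma> 2 a')) = 2"
    by simp
  moreover have "\<not> lhs_description (2 ^ M) (2 ^ (N - M)) \<sigma> (reduced_state M N \<rho>)"
    using lhs_description_imp_proportional[of "2 ^ M" "2 ^ (N - M)" \<sigma>] pure_req measurement_req
    by blast
  \<comment> \<open>The middle claim, the value 1 under an LHS description, is an implication whose
    premise has just been refuted.\<close>
  ultimately show ?thesis by blast
qed

end
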